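(* Let $1<p<s<\infty$, $n\ge2$, let $\Omega\subseteq\mathbb{R}^n$ be a domain, and let $a=(a_1,\dots,a_n)$ be a weight vector as in the context. Then there exists a positive constant $C(p,s)$, depending only on $p$ and $s$, such that for almost all $x\in\Omega$ and all $\xi,\eta\in\mathbb{R}^n$ with $\xi\ne0$, $$|\xi+\eta|_{s,a}^{p}-|\xi|_{s,a}^{p}-p|\xi|_{s,a}^{p-s}\sum_{i=1}^{n}a_{i}(x)|\xi_{i}|^{s-2}\xi_{i}\eta_{i}\ \le\ C(p,s)\,|\xi|_{s,a}^{p-s}\sum_{i=1}^{n}|\eta'_{i}|^{2}\left(|\eta'_{i}|+|\xi'_{i}|\right)^{s-2}.$$
   Context: The functions $a_1,\dots,a_n:\Omega\to(0,\infty)$ are Lebesgue measurable and locally equivalent to $1$: for every domain $\omega$ whose closure is a compact subset of $\Omega$ there are constants $0<c_\omega\le C_\omega<\infty$ with $c_\omega\le a_i\le C_\omega$ a.e. in $\omega$. For almost all $x\in\Omega$ and $\xi\in\mathbb{R}^n$, $|\xi|_{s,a}=\left(\sum_{i=1}^n a_i(x)|\xi_i|^s\right)^{1/s}$, and $\xi_i'=a_i(x)^{1/s}\xi_i$ (similarly $\eta_i'$). Conventions: $|t|^{s-2}t=0$ for $t=0$, and $t^2(t+\tau)^{s-2}=0$ when $t=\tau=0$. (The left-hand side is the Bregman distance of $|\cdot|_{s,a}^p$ at $(\xi+\eta,\xi)$.) *)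

theory Defs
  imports "HOL-Analysis.Analysis"
begin

text \<open>
  The space of dimension \<open>n\<close> is the set of extensional functions on \<open>{1..n}\<close>, and not
  \<^typ>\<open>real ^ 'n\<close>: the constant in the theorem must not depend on the dimension, so \<open>n\<close>
  has to be quantified inside the scope of that constant.
\<close>

definition Rn :: "nat \<Rightarrow> (nat \<Rightarrow> real) set" where
  "Rn n = {1..n} \<rightarrow>\<^sub>E UNIV"

definition Rn_topology :: "nat \<Rightarrow> (nat \<Rightarrow> real) topology" where
  "Rn_topology n = product_topology (\<lambda>_. euclideanreal) {1..n}"

definition Rn_lebesgue :: "nat \<Rightarrow> (nat \<Rightarrow> real) measure" where
  "Rn_lebesgue n = completion (Pi\<^sub>M {1..n} (\<lambda>_. lborel))"

definition Rn_zero :: "nat \<Rightarrow> nat \<Rightarrow> real" where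
  "Rn_zero n = (\<lambda>i\<in>{1..n}. 0)"

definition Rn_add :: "nat \<Rightarrow> (nat \<Rightarrow> real) \<Rightarrow> (nat \<Rightarrow> real) \<Rightarrow> nat \<Rightarrow> real" where
  "Rn_add n \<xi> \<eta> = (\<lambda>i\<in>{1..n}. \<xi> i + \<eta> i)"

lemma topspace_Rn_topology: "topspace (Rn_topology n) = Rn n"
  by (simp add: Rn_topology_def Rn_def)

lemma space_Rn_lebesgue: "space (Rn_lebesgue n) = Rn n"
  by (simp add: Rn_lebesgue_def Rn_def space_PiM)

definition Rn_domain :: "nat \<Rightarrow> (nat \<Rightarrow> real) set \<Rightarrow> bool" where
  "Rn_domain n \<Omega> \<longleftrightarrow>
     \<Omega> \<noteq> {} \<and> openin (Rn_topology n) \<Omega> \<and> connectedin (Rn_topology n) \<Omega>"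

text \<open>
  In \<open>a i x\<close> the first argument is the index of the weight and the second the point; values
  outside \<open>\<Omega>\<close> are irrelevant.
\<close>

definition weight_vector ::
    "nat \<Rightarrow> (nat \<Rightarrow> real) set \<Rightarrow> (nat \<Rightarrow> (nat \<Rightarrow> real) \<Rightarrow> real) \<Rightarrow> bool" where
  "weight_vector n \<Omega> a \<longleftrightarrow>
     (\<forall>i\<in>{1..n}. a i \<in> borel_measurable (restrict_space (Rn_lebesgue n) \<Omega>)) \<and>
     (\<forall>i\<in>{1..n}. \<forall>x\<in>\<Omega>. 0 < a i x) \<and>
     (\<forall>\<omega>. Rn_domain n \<omega> \<and> compactin (Rn_topology n) (Rn_topology n closure_of \<omega>) \<and>
          Rn_topology n closure_of \<omega> \<subseteq> \<Omega> \<longrightarrow>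
        (\<exists>c C. 0 < c \<and> c \<le> C \<and>
           (\<forall>i\<in>{1..n}. AE x in Rn_lebesgue n. x \<in> \<omega> \<longrightarrow> c \<le> a i x \<and> a i x \<le> C)))"

definition weighted_norm ::
    "nat \<Rightarrow> real \<Rightarrow> (nat \<Rightarrow> (nat \<Rightarrow> real) \<Rightarrow> real) \<Rightarrow> (nat \<Rightarrow> real) \<Rightarrow> (nat \<Rightarrow> real) \<Rightarrow> real" where
  "weighted_norm n s a x \<xi> = (\<Sum>i=1..n. a i x * \<bar>\<xi> i\<bar> powr s) powr (1 / s)"

text \<open>The components of \<open>\<xi>'\<close>.\<close>

definition rescaled ::
    "real \<Rightarrow> (nat \<Rightarrow> (nat \<Rightarrow> real) \<Rightarrow> real) \<Rightarrow> (nat \<Rightarrow> real) \<Rightarrow> (nat \<Rightarrow> real) \<Rightarrow> nat \<Rightarrow> real" where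
  "rescaled s a x \<xi> i = a i x powr (1 / s) * \<xi> i"

text \<open>
  Since \<open>0 powr r = 0\<close> for every \<open>r\<close>, the terms \<open>\<bar>t\<bar> powr (s - 2) * t\<close> at \<open>t = 0\<close> and
  \<open>t\<^sup>2 * (t + \<tau>) powr (s - 2)\<close> at \<open>t = \<tau> = 0\<close> vanish, also when \<open>s \<le> 2\<close>.
\<close>

end

theory Submission imports Defs begin

text \<open>
  The bound holds at every \<open>x\<close>. With \<open>A\<close>, \<open>B\<close> the sums of \<open>\<bar>\<xi>'\<^sub>i\<bar>\<^sup>s\<close> and \<open>\<bar>\<xi>'\<^sub>i + \<eta>'\<^sub>i\<bar>\<^sup>s\<close>, the
  function \<open>t\<^sup>p\<^sup>/\<^sup>s\<close> is concave because \<open>p < s\<close>, so it lies below its tangent at \<open>A\<close>; this bounds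
  the left-hand side by \<open>p/s A\<^sup>p\<^sup>/\<^sup>s\<^sup>-\<^sup>1\<close> times the sum over \<open>i\<close> of the one-dimensional Bregman distances of
  \<open>\<bar>t\<bar>\<^sup>s\<close>. Each of these is estimated crudely if \<open>\<bar>\<xi>'\<^sub>i\<bar> \<le> 2\<bar>\<eta>'\<^sub>i\<bar>\<close>, and otherwise by the second
  derivative, all points between \<open>\<xi>'\<^sub>i\<close> and \<open>\<xi>'\<^sub>i + \<eta>'\<^sub>i\<close> being comparable to \<open>\<bar>\<eta>'\<^sub>i\<bar> + \<bar>\<xi>'\<^sub>i\<bar>\<close>.
\<close>

section \<open>The one-dimensional Bregman distance of \<open>|t|^s\<close>\<close>

text \<open>Monotonicity of \<open>t powr r\<close> settles \<open>r \<ge> 0\<close> from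
  \<open>u \<le> c * v\<close>, and antitonicity settles \<open>r < 0\<close> from
  \<open>v \<le> c * u\<close>. Two-sided comparability thus covers the exponent
  \<open>s - 2\<close>, whose sign is open.\<close>

lemma powr_le_powr_of_comparable:
  fixes c r u v :: real
  assumes "c \<ge> 1" "u > 0" "v > 0" "u \<le> c * v" "v \<le> c * u"
  shows "u powr r \<le> c powr \<bar>r\<bar> * v powr r"
proof (cases "r \<ge> 0")
  case True
  then have "u powr r \<le> (c * v) powr r"
    using assms by (intro powr_mono2) auto
  then show ?thesis
    using True assms by (simp add: powr_mult)
next
  case False
  then have "(c * u) powr r \<le> v powr r"
    using assms by (intro powr_mono2') auto
  then have "c powr (- r) * (c powr r * u powr r) \<le> c powr (- r) * v powr r"
    using assms by (intro mult_left_mono) (auto simp: powr_mult)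
  moreover have "c powr (- r) * (c powr r * u powr r) = u powr r"
    using assms by (simp add: powr_minus)
  ultimately show ?thesis
    using False by simp
qed

text \<open>Taylor's formula is replaced by two uses of the mean value theorem, first for
  \<open>t powr s\<close> and then for \<open>t powr (s - 1)\<close>. The condition on
  \<open>y\<close> keeps all intermediate points away from 0.\<close>

lemma powr_taylor_bound:
  fixes s x y :: real
  assumes s: "s > 1" and x: "x > 0" and y: "2 * \<bar>y\<bar> < x"
  shows "(x + y) powr s - x powr s - s * x powr (s - 1) * y
    \<le> s * s * 3 powr \<bar>s - 2\<bar> * (y\<^sup>2 * (\<bar>y\<bar> + x) powr (s - 2))"
proof -
  let ?I = "{x - \<bar>y\<bar>..x + \<bar>y\<bar>}"
  have pos: "t > 0" if "t \<in> ?I" for t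
    using that x y by auto
  \<comment> \<open>The bound on \<open>z - x\<close> is what later turns \<open>(z - x) * y\<close>
    into at most \<open>y\<^sup>2\<close>.\<close>
  have MVT: "\<exists>z\<in>?I. \<bar>z - x\<bar> \<le> \<bar>w - x\<bar> \<and> w powr r - x powr r = r * z powr (r - 1) * (w - x)"
    if w: "w \<in> ?I" for w r
  proof -
    consider "w = x" | "w < x" | "x < w" by linarith
    then show ?thesis
    proof cases
      case 1
      then show ?thesis using x by (intro bexI[of _ x]) auto
    next
      case 2
      have "\<exists>z>w. z < x \<and> x powr r - w powr r = (x - w) * (r * z powr (r - 1))"
        using 2 w pos[OF w] by (intro MVT2) (auto intro!: derivative_eq_intros)
      then obtain z where "z > w" "z < x" "x powr r - w powr r = (x - w) * (r * z powr (r - 1))"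
        by blast
      with 2 w show ?thesis
        by (intro bexI[of _ z]) (auto simp: algebra_simps)
    next
      case 3
      have "\<exists>z>x. z < w \<and> w powr r - x powr r = (w - x) * (r * z powr (r - 1))"
        using 3 x by (intro MVT2) (auto intro!: derivative_eq_intros)
      then obtain z where "z > x" "z < w" "w powr r - x powr r = (w - x) * (r * z powr (r - 1))"
        by blast
      with 3 w show ?thesis
        by (intro bexI[of _ z]) (auto simp: algebra_simps)
    qed
  qed
  have "x + y \<in> ?I" by auto
  from MVT[OF this, of s] obtain z where z: "z \<in> ?I" "\<bar>z - x\<bar> \<le> \<bar>y\<bar>"
    "(x + y) powr s - x powr s = s * z powr (s - 1) * y"
    by auto
  from MVT[OF z(1), of "s - 1"] obtain v where v: "v \<in> ?I"
    "z powr (s - 1) - x powr (s - 1) = (s - 1) * v powr (s - 2) * (z - x)"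
    by (auto simp: algebra_simps)
  have "(z - x) * y \<le> y\<^sup>2"
    using z(2) by (metis abs_le_square_iff abs_mult abs_ge_self abs_ge_zero mult_right_mono order_trans power2_abs power2_eq_square)
  have "(x + y) powr s - x powr s - s * x powr (s - 1) * y
      = s * (z powr (s - 1) - x powr (s - 1)) * y"
    unfolding z(3) by (simp add: algebra_simps)
  also have "\<dots> = s * (s - 1) * v powr (s - 2) * ((z - x) * y)"
    unfolding v(2) by (simp add: algebra_simps)
  also have "\<dots> \<le> s * s * (3 powr \<bar>s - 2\<bar> * (\<bar>y\<bar> + x) powr (s - 2)) * y\<^sup>2"
  proof (rule order_trans[OF mult_left_mono[OF \<open>(z - x) * y \<le> y\<^sup>2\<close>]])
    \<comment> \<open>Since \<open>2 * \<bar>y\<bar> < x\<close>, we get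
      \<open>\<bar>y\<bar> + x \<le> 3 * (x - \<bar>y\<bar>) \<le> 3 * v\<close>; this fixes the
      factor 3.\<close>
    have "v powr (s - 2) \<le> 3 powr \<bar>s - 2\<bar> * (\<bar>y\<bar> + x) powr (s - 2)"
      using v(1) x y by (intro powr_le_powr_of_comparable) auto
    then show "s * (s - 1) * v powr (s - 2) * y\<^sup>2
        \<le> s * s * (3 powr \<bar>s - 2\<bar> * (\<bar>y\<bar> + x) powr (s - 2)) * y\<^sup>2"
      using s by (intro mult_right_mono mult_mono) auto
  qed (use s in auto)
  finally show ?thesis by (simp add: algebra_simps)
qed

text \<open>The summand \<open>s * s\<close> serves the Taylor case, the other two the crude case;
  the last factor is the price of comparability in both.\<close>

definition bregman_const :: "real \<Rightarrow> real" where
  "bregman_const s = (3 powr s + s * 2 powr s + s * s) * 3 powr \<bar>s - 2\<bar>"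

lemma bregman_abs_powr_le:
  fixes s x y :: real
  assumes s: "s > 1"
  shows "\<bar>x + y\<bar> powr s - \<bar>x\<bar> powr s - s * (\<bar>x\<bar> powr (s - 2) * x * y)
    \<le> bregman_const s * (\<bar>y\<bar>\<^sup>2 * (\<bar>y\<bar> + \<bar>x\<bar>) powr (s - 2))"
proof (cases "2 * \<bar>y\<bar> < \<bar>x\<bar>")
  case True
  have *: "\<bar>x + y\<bar> powr s - \<bar>x\<bar> powr s - s * (\<bar>x\<bar> powr (s - 2) * x * y)
    \<le> s * s * 3 powr \<bar>s - 2\<bar> * (\<bar>y\<bar>\<^sup>2 * (\<bar>y\<bar> + \<bar>x\<bar>) powr (s - 2))"
  proof (cases "x > 0")
    case xpos: True
    have "x powr (s - 1) = x powr (s - 2) * x"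
      using xpos powr_add[of x "s - 2" 1] by simp
    with powr_taylor_bound[OF s xpos, of y] True xpos show ?thesis
      by (simp add: mult.assoc)
  next
    case False
    \<comment> \<open>Both sides are unchanged when \<open>x\<close> and \<open>y\<close> change
      sign together, so the positive case applies to \<open>- x\<close> and
      \<open>- y\<close>.\<close>
    with True have xneg: "- x > 0" by auto
    have "(- x) powr (s - 1) = (- x) powr (s - 2) * (- x)"
      using xneg powr_add[of "- x" "s - 2" 1] by simp
    moreover have "\<bar>x\<bar> = - x" "\<bar>x + y\<bar> = - x + - y"
      using xneg True by auto
    ultimately show ?thesis
      using powr_taylor_bound[OF s xneg, of "- y"] True by (simp add: mult.assoc)
  qed
  show ?thesis
    using s by (intro order_trans[OF *] mult_right_mono) (auto simp: bregman_const_def)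
next
  case False
  show ?thesis
  proof (cases "y = 0")
    case False
    with \<open>\<not> 2 * \<bar>y\<bar> < \<bar>x\<bar>\<close> have xy: "\<bar>x\<bar> \<le> 2 * \<bar>y\<bar>" "\<bar>y\<bar> > 0" by auto
    have "\<bar>x + y\<bar> powr s \<le> (3 * \<bar>y\<bar>) powr s"
      using s xy by (intro powr_mono2) auto
    then have 1: "\<bar>x + y\<bar> powr s \<le> 3 powr s * \<bar>y\<bar> powr s"
      by (simp add: powr_mult)
    have "- (\<bar>x\<bar> powr (s - 2) * x * y) \<le> \<bar>x\<bar> powr (s - 2) * \<bar>x\<bar> * \<bar>y\<bar>"
      using abs_ge_minus_self[of "\<bar>x\<bar> powr (s - 2) * x * y"] by (simp add: abs_mult)
    also have "\<dots> = \<bar>x\<bar> powr (s - 1) * \<bar>y\<bar>"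
      using powr_add[of "\<bar>x\<bar>" "s - 2" 1] by (cases "x = 0") auto
    also have "\<dots> \<le> (2 * \<bar>y\<bar>) powr (s - 1) * \<bar>y\<bar>"
      using s xy by (intro mult_right_mono powr_mono2) auto
    also have "\<dots> = 2 powr (s - 1) * \<bar>y\<bar> powr s"
      using xy powr_add[of "\<bar>y\<bar>" "s - 1" 1] by (simp add: powr_mult)
    also have "\<dots> \<le> 2 powr s * \<bar>y\<bar> powr s"
      by (intro mult_right_mono powr_mono) auto
    finally have 2: "s * - (\<bar>x\<bar> powr (s - 2) * x * y) \<le> s * (2 powr s * \<bar>y\<bar> powr s)"
      using s by (intro mult_left_mono) auto
    \<comment> \<open>Here \<open>\<bar>y\<bar> \<le> \<bar>y\<bar> + \<bar>x\<bar> \<le> 3 *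
      \<bar>y\<bar>\<close>, so the two bases are comparable with the same factor 3.\<close>
    have "\<bar>y\<bar> powr s = \<bar>y\<bar>\<^sup>2 * \<bar>y\<bar> powr (s - 2)"
      using xy powr_add[of "\<bar>y\<bar>" 2 "s - 2"] by simp
    also have "\<dots> \<le> \<bar>y\<bar>\<^sup>2 * (3 powr \<bar>s - 2\<bar> * (\<bar>y\<bar> + \<bar>x\<bar>) powr (s - 2))"
      using xy by (intro mult_left_mono powr_le_powr_of_comparable) auto
    finally have 3: "\<bar>y\<bar> powr s \<le> 3 powr \<bar>s - 2\<bar> * (\<bar>y\<bar>\<^sup>2 * (\<bar>y\<bar> + \<bar>x\<bar>) powr (s - 2))"
      by (simp add: mult_ac)
    have "\<bar>x + y\<bar> powr s - \<bar>x\<bar> powr s - s * (\<bar>x\<bar> powr (s - 2) * x * y)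
        \<le> (3 powr s + s * 2 powr s + s * s) * \<bar>y\<bar> powr s"
    proof -
      have "0 \<le> s * (s * \<bar>y\<bar> powr s)" "0 \<le> \<bar>x\<bar> powr s" using s by auto
      with 1 2 show ?thesis unfolding distrib_right mult.assoc by linarith
    qed
    also have "\<dots> \<le> (3 powr s + s * 2 powr s + s * s)
        * (3 powr \<bar>s - 2\<bar> * (\<bar>y\<bar>\<^sup>2 * (\<bar>y\<bar> + \<bar>x\<bar>) powr (s - 2)))"
      using 3 s by (intro mult_left_mono) auto
    finally show ?thesis by (simp add: bregman_const_def mult.assoc)
  qed simp
qed

section \<open>Concavity of powers with exponent below 1\<close>

text \<open>This is Young's inequality for \<open>B powr q * A powr (1 - q)\<close>, divided by
  \<open>A powr (1 - q)\<close>. The value \<open>B = 0\<close>, attained for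
  \<open>\<eta> = -\<xi>\<close>, is treated apart because Young's inequality is applied to positive
  numbers.\<close>

lemma powr_le_tangent:
  fixes A B q :: real
  assumes "0 < A" "0 \<le> B" "0 < q" "q < 1"
  shows "B powr q - A powr q \<le> q * A powr (q - 1) * (B - A)"
proof (cases "B = 0")
  case True
  have "A powr (q - 1) * A = A powr q"
    using assms powr_add[of A "q - 1" 1] by simp
  moreover have "q * A powr q \<le> A powr q"
    using assms by (simp add: mult_left_le_one_le)
  ultimately show ?thesis
    using True by (simp add: mult.assoc)
next
  case False
  have "B powr q * A powr (1 - q) \<le> q * B + (1 - q) * A"
    using assms False by (intro Youngs_inequality_0) auto
  then have "A powr (q - 1) * (B powr q * A powr (1 - q)) \<le> A powr (q - 1) * (q * B + (1 - q) * A)"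
    by (intro mult_left_mono) auto
  moreover have "A powr (q - 1) * (B powr q * A powr (1 - q)) = B powr q"
    using assms powr_add[of A "q - 1" "1 - q"] by (simp add: mult.left_commute)
  moreover have "A powr (q - 1) * (q * B + (1 - q) * A) = q * A powr (q - 1) * (B - A) + A powr (q - 1) * A"
    by (simp add: algebra_simps)
  moreover have "A powr (q - 1) * A = A powr q"
    using assms powr_add[of A "q - 1" 1] by simp
  ultimately show ?thesis
    by linarith
qed

section \<open>Passage to rescaled coordinates and summation\<close>

lemma rescaled_powr:
  assumes "0 < a i x" "s > 0"
  shows "\<bar>rescaled s a x \<xi> i\<bar> powr s = a i x * \<bar>\<xi> i\<bar> powr s"
  using assms by (simp add: rescaled_def abs_mult powr_mult powr_powr)

lemma rescaled_mult:
  assumes "0 < a i x" "s > 0"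
  shows "\<bar>rescaled s a x \<xi> i\<bar> powr (s - 2) * rescaled s a x \<xi> i * rescaled s a x \<eta> i
    = a i x * \<bar>\<xi> i\<bar> powr (s - 2) * \<xi> i * \<eta> i"
proof -
  have "a i x powr ((s - 2) / s) * a i x powr (1 / s) * a i x powr (1 / s)
      = a i x powr ((s - 2) / s + 1 / s + 1 / s)"
    by (simp only: powr_add)
  also have "(s - 2) / s + 1 / s + 1 / s = 1"
    using assms by (simp add: field_simps)
  also have "a i x powr 1 = a i x"
    using assms by simp
  finally have *: "a i x powr ((s - 2) / s) * a i x powr (1 / s) * a i x powr (1 / s) = a i x" .
  have "\<bar>rescaled s a x \<xi> i\<bar> powr (s - 2) * rescaled s a x \<xi> i * rescaled s a x \<eta> i
      = (a i x powr ((s - 2) / s) * a i x powr (1 / s) * a i x powr (1 / s))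
        * (\<bar>\<xi> i\<bar> powr (s - 2) * \<xi> i * \<eta> i)"
    by (simp add: rescaled_def abs_mult powr_mult powr_powr)
  then show ?thesis
    unfolding * by (simp only: mult.assoc)
qed

lemma weighted_norm_bregman_le:
  fixes p s :: real
  assumes ps: "1 < p" "p < s"
    and a: "\<And>i. i \<in> {1..n} \<Longrightarrow> 0 < a i x"
    and \<xi>: "\<xi> \<in> Rn n" "\<xi> \<noteq> Rn_zero n"
  shows "weighted_norm n s a x (Rn_add n \<xi> \<eta>) powr p - weighted_norm n s a x \<xi> powr p
      - p * weighted_norm n s a x \<xi> powr (p - s) * (\<Sum>i=1..n. a i x * \<bar>\<xi> i\<bar> powr (s - 2) * \<xi> i * \<eta> i)
    \<le> p / s * bregman_const s * weighted_norm n s a x \<xi> powr (p - s)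
      * (\<Sum>i=1..n. \<bar>rescaled s a x \<eta> i\<bar>\<^sup>2
          * (\<bar>rescaled s a x \<eta> i\<bar> + \<bar>rescaled s a x \<xi> i\<bar>) powr (s - 2))"
proof -
  let ?X = "rescaled s a x \<xi>" and ?Y = "rescaled s a x \<eta>"
  define A where "A = (\<Sum>i=1..n. \<bar>?X i\<bar> powr s)"
  define B where "B = (\<Sum>i=1..n. \<bar>?X i + ?Y i\<bar> powr s)"
  define D where "D = (\<Sum>i=1..n. \<bar>?X i\<bar> powr (s - 2) * ?X i * ?Y i)"
  define R where "R = (\<Sum>i=1..n. \<bar>?Y i\<bar>\<^sup>2 * (\<bar>?Y i\<bar> + \<bar>?X i\<bar>) powr (s - 2))"
  have s: "s > 0" "s > 1" using ps by auto
  \<comment> \<open>Used for \<open>r = p\<close> and for \<open>r = p - s\<close>; the latter is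
    the power of \<open>A\<close> in the slope of the tangent.\<close>
  have normA: "weighted_norm n s a x \<xi> powr r = A powr (r / s)" for r
    using a s by (simp add: weighted_norm_def A_def rescaled_powr powr_powr)
  have "(\<Sum>i=1..n. a i x * \<bar>Rn_add n \<xi> \<eta> i\<bar> powr s) = B"
    unfolding B_def
  proof (rule sum.cong)
    fix i assume i: "i \<in> {1..n}"
    have "?X i + ?Y i = rescaled s a x (Rn_add n \<xi> \<eta>) i"
      using i by (simp add: rescaled_def Rn_add_def algebra_simps)
    with rescaled_powr[of a i x s "Rn_add n \<xi> \<eta>"] a[OF i] s
    show "a i x * \<bar>Rn_add n \<xi> \<eta> i\<bar> powr s = \<bar>?X i + ?Y i\<bar> powr s" by simp
  qed simp
  then have normB: "weighted_norm n s a x (Rn_add n \<xi> \<eta>) powr p = B powr (p / s)"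
    by (simp add: weighted_norm_def powr_powr)
  have D: "(\<Sum>i=1..n. a i x * \<bar>\<xi> i\<bar> powr (s - 2) * \<xi> i * \<eta> i) = D"
    unfolding D_def using a s by (intro sum.cong) (auto simp: rescaled_mult)
  \<comment> \<open>The tangent at \<open>A\<close> requires \<open>A > 0\<close>. Elements of
    \<open>Rn n\<close> are extensional, so one that differs from \<open>Rn_zero n\<close> does so
    at an index in \<open>{1..n}\<close>.\<close>
  obtain j where j: "j \<in> {1..n}" "\<xi> j \<noteq> 0"
  proof -
    have "\<exists>j\<in>{1..n}. \<xi> j \<noteq> 0"
    proof (rule ccontr)
      assume "\<not> ?thesis"
      then have "\<xi> = Rn_zero n"
        using \<xi>(1) by (intro PiE_ext[of _ "{1..n}" "\<lambda>_. UNIV"]) (auto simp: Rn_def Rn_zero_def)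
      with \<xi>(2) show False by simp
    qed
    with that show ?thesis by blast
  qed
  then have "0 < \<bar>?X j\<bar> powr s"
    using a[OF j(1)] by (simp add: rescaled_def)
  also have "\<dots> \<le> A"
    unfolding A_def using j by (intro member_le_sum) auto
  finally have A: "A > 0" .
  have B: "B \<ge> 0" by (auto simp: B_def intro: sum_nonneg)
  have "B - A - s * D
      = (\<Sum>i=1..n. \<bar>?X i + ?Y i\<bar> powr s - \<bar>?X i\<bar> powr s - s * (\<bar>?X i\<bar> powr (s - 2) * ?X i * ?Y i))"
    by (simp add: A_def B_def D_def sum_subtractf sum_distrib_left)
  also have "\<dots> \<le> bregman_const s * R"
    unfolding R_def sum_distrib_left using s by (intro sum_mono bregman_abs_powr_le)
  finally have *: "B - A - s * D \<le> bregman_const s * R" .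
  have "B powr (p / s) - A powr (p / s) \<le> p / s * A powr (p / s - 1) * (B - A)"
    using A B ps by (intro powr_le_tangent) auto
  \<comment> \<open>The linear term is given the factor \<open>p / s\<close> of the slope, so that
    it joins \<open>B - A\<close> to form the sum of one-dimensional Bregman distances.\<close>
  moreover have "p * A powr (p / s - 1) * D = p / s * A powr (p / s - 1) * (s * D)"
    using s by simp
  ultimately have "B powr (p / s) - A powr (p / s) - p * A powr (p / s - 1) * D
      \<le> p / s * A powr (p / s - 1) * (B - A - s * D)"
    by (simp only: right_diff_distrib)
  also have "\<dots> \<le> p / s * A powr (p / s - 1) * (bregman_const s * R)"
    using * ps by (intro mult_left_mono) auto
  finally have "B powr (p / s) - A powr (p / s) - p * A powr (p / s - 1) * D
      \<le> p / s * A powr (p / s - 1) * (bregman_const s * R)" .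
  moreover have "(p - s) / s = p / s - 1"
    using s by (simp add: diff_divide_distrib)
  ultimately show ?thesis
    unfolding D normA normB R_def[symmetric] by (simp add: mult_ac)
qed

theorem lemma3p10:
  fixes p s :: real
  assumes "1 < p" and "p < s"
  shows "\<exists>C>0. \<forall>(n::nat) \<Omega> a. n \<ge> 2 \<and> Rn_domain n \<Omega> \<and> weight_vector n \<Omega> a \<longrightarrow>
    (AE x in Rn_lebesgue n. x \<in> \<Omega> \<longrightarrow>
      (\<forall>\<xi>\<in>Rn n. \<forall>\<eta>\<in>Rn n. \<xi> \<noteq> Rn_zero n \<longrightarrow>
        weighted_norm n s a x (Rn_add n \<xi> \<eta>) powr p
          - weighted_norm n s a x \<xi> powr p
          - p * weighted_norm n s a x \<xi> powr (p - s)
              * (\<Sum>i=1..n. a i x * \<bar>\<xi> i\<bar> powr (s - 2) * \<xi> i * \<eta> i)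
        \<le> C * weighted_norm n s a x \<xi> powr (p - s)
            * (\<Sum>i=1..n. \<bar>rescaled s a x \<eta> i\<bar>\<^sup>2
                * (\<bar>rescaled s a x \<eta> i\<bar> + \<bar>rescaled s a x \<xi> i\<bar>) powr (s - 2))))"
\<comment> \<open>The witness is chosen before \<open>n\<close>, \<open>\<Omega>\<close> and
  \<open>a\<close>, and contains only \<open>p\<close> and \<open>s\<close>.\<close>
proof (intro exI[of _ "p / s * bregman_const s"] conjI allI impI AE_I2 ballI)
  have "bregman_const s > 0"
    unfolding bregman_const_def using assms by (intro mult_pos_pos add_pos_nonneg) auto
  then show "0 < p / s * bregman_const s"
    using assms by simp
qed (rule weighted_norm_bregman_le; use assms in \<open>auto simp: weight_vector_def\<close>)

end
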